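(* Let $n\in\mathbb N$, $n\ge1$, let $s\in(0,\infty)\setminus\mathbb N$ and let $A$ be a Young function. Then $$B^{s,A}(\mathbb R^n)=W^{s,A}(\mathbb R^n),$$ with norms equivalent up to constants depending on $n$; that is, there exist positive constants $c_1,c_2$ depending only on $n$ such that $c_1\|u\|_{B^{s,A}(\mathbb R^n)}\le\|u\|_{W^{s,A}(\mathbb R^n)}\le c_2\|u\|_{B^{s,A}(\mathbb R^n)}$ for every $u$ in this common space.
   Context: A Young function is a function $A:[0,\infty)\to[0,\infty]$ that is convex, left-continuous, vanishes at $0$, and is neither identically $0$ nor identically $\infty$ (on $(0,\infty)$). $\mathcal M(\mathbb R^n)$ is the space of real-valued measurable functions on $\mathbb R^n$. The Luxemburg norm is $\|u\|_{L^A(\mathbb R^n)}=\inf\{\lambda>0:\int_{\mathbb R^n}A(|u(x)|/\lambda)\,dx\le1\}$, and $L^A(\mathbb R^n)$ is the set of $u\in\mathcal M(\mathbb R^n)$ with finite norm. For $m\in\mathbb N$, $W^{m,A}(\mathbb R^n)=\{u\in L^A(\mathbb R^n):|\nabla^ku|\in L^A(\mathbb R^n),\ k=1,\dots,m\}$ with norm $\sum_{k=0}^m\|\nabla^ku\|_{L^A(\mathbb R^n)}$, where $\nabla^ku$ is the vector of all weak derivatives of $u$ of order $k$ and $\nabla^0u=u$. Fractional Orlicz-Sobolev spaces: for $s\in(0,1)$, $$|u|_{s,A,\mathbb R^n}=\inf\Big\{\lambda>0:\int_{\mathbb R^n}\int_{\mathbb R^n}A\Big(\frac{|u(x)-u(y)|}{\lambda|x-y|^s}\Big)\frac{dx\,dy}{|x-y|^n}\le1\Big\}$$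 (also for vector-valued $u$), $W^{s,A}(\mathbb R^n)=\{u\in L^A(\mathbb R^n):|u|_{s,A,\mathbb R^n}<\infty\}$, with norm $\|u\|_{L^A(\mathbb R^n)}+|u|_{s,A,\mathbb R^n}$. For $s\in(1,\infty)\setminus\mathbb N$, with $[s]$ the integer part and $\{s\}=s-[s]$, $W^{s,A}(\mathbb R^n)=\{u\in W^{[s],A}(\mathbb R^n):|\nabla^{[s]}u|_{\{s\},A,\mathbb R^n}<\infty\}$ with norm $\|u\|_{W^{[s],A}(\mathbb R^n)}+|\nabla^{[s]}u|_{\{s\},A,\mathbb R^n}$. Besov type spaces: for $s\in(0,1)$, with $e_1,\dots,e_n$ the canonical basis of $\mathbb R^n$, $$|u|_{B^{s,A}(\mathbb R^n)}=\inf\Big\{\lambda>0:\sum_{j=1}^n\int_0^\infty\int_{\mathbb R^n}A\Big(\frac{|u(x+\varrho e_j)-u(x)|}{\lambda\,\varrho^s}\Big)dx\,\frac{d\varrho}{\varrho}\le1\Big\}$$ (also for vector-valued $u$), $B^{s,A}(\mathbb R^n)=\{u\in L^A(\mathbb R^n):|u|_{B^{s,A}(\mathbb R^n)}<\infty\}$, with norm $\|u\|_{B^{s,A}(\mathbb R^n)}=\|u\|_{L^A(\mathbb R^n)}+|u|_{B^{s,A}(\mathbb R^n)}$. For $s\in(1,\infty)\setminus\mathbb N$, $B^{s,A}(\mathbb R^n)=\{u\in W^{[s],A}(\mathbb R^n):|\nabla^{[s]}u|_{B^{\{s\},A}(\mathbb R^n)}<\infty\}$ with norm $\|u\|_{B^{s,A}(\mathbb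 R^n)}=\|u\|_{W^{[s],A}(\mathbb R^n)}+|\nabla^{[s]}u|_{B^{\{s\},A}(\mathbb R^n)}$. *)

theory Defs
  imports "HOL-Analysis.Analysis"
begin

text \<open>
  Young functions \<open>[0,\<infinity>) \<rightarrow> [0,\<infinity>]\<close> are functions on all of \<^typ>\<open>real\<close>;
  only their values on \<open>[0,\<infinity>)\<close> are constrained, and only these are ever used below.
\<close>
definition young_function :: "(real \<Rightarrow> ennreal) \<Rightarrow> bool" where
  "young_function A \<longleftrightarrow>
     (\<forall>x\<ge>0. \<forall>y\<ge>0. \<forall>t\<in>{0..1}.
        A ((1 - t) * x + t * y) \<le> ennreal (1 - t) * A x + ennreal t * A y) \<and>
     (\<forall>x>0. continuous (at_left x) A) \<and>
     A 0 = 0 \<and>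
     (\<exists>x>0. A x \<noteq> 0) \<and>
     (\<exists>x>0. A x \<noteq> \<infinity>)"

text \<open>
  All norms take values in \<^typ>\<open>ennreal\<close>, so that the infimum of the empty set is \<open>\<infinity>\<close>.
  Spaces are sets of measurable functions; functions equal almost everywhere are not identified.
\<close>
definition luxemburg_norm :: "(real \<Rightarrow> ennreal) \<Rightarrow> (real^'n \<Rightarrow> real) \<Rightarrow> ennreal" where
  "luxemburg_norm A u =
     Inf {ennreal l | l. l > 0 \<and> (\<integral>\<^sup>+x. A (\<bar>u x\<bar> / l) \<partial>lebesgue) \<le> 1}"

definition orlicz_space :: "(real \<Rightarrow> ennreal) \<Rightarrow> (real^'n \<Rightarrow> real) set" where
  "orlicz_space A = {u \<in> borel_measurable lebesgue. luxemburg_norm A u < \<infinity>}"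

definition partial_deriv :: "'n \<Rightarrow> (real^'n \<Rightarrow> real) \<Rightarrow> real^'n \<Rightarrow> real" where
  "partial_deriv j f x = frechet_derivative f (at x) (axis j 1)"

fun Ck :: "nat \<Rightarrow> (real^'n \<Rightarrow> real) \<Rightarrow> bool" where
  "Ck 0 f \<longleftrightarrow> continuous_on UNIV f"
| "Ck (Suc k) f \<longleftrightarrow> (\<forall>x. f differentiable at x) \<and> (\<forall>j. Ck k (partial_deriv j f))"

definition test_function :: "(real^'n \<Rightarrow> real) \<Rightarrow> bool" where
  "test_function \<phi> \<longleftrightarrow> (\<forall>k. Ck k \<phi>) \<and> compact (closure {x. \<phi> x \<noteq> 0})"

definition multi_indices :: "nat \<Rightarrow> ('n::finite \<Rightarrow> nat) set" where
  "multi_indices k = {\<alpha>. (\<Sum>j\<in>UNIV. \<alpha> j) = k}"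

text \<open>
  The partial derivatives are taken one after the other along a list that contains each
  direction \<open>j\<close> exactly \<open>\<alpha> j\<close> times. For the smooth functions to which this is applied, the
  order is immaterial.
\<close>
definition multi_deriv :: "('n \<Rightarrow> nat) \<Rightarrow> (real^'n \<Rightarrow> real) \<Rightarrow> real^'n \<Rightarrow> real" where
  "multi_deriv \<alpha> f = foldr partial_deriv (SOME js. \<forall>j. count_list js j = \<alpha> j) f"

definition locally_integrable :: "(real^'n \<Rightarrow> real) \<Rightarrow> bool" where
  "locally_integrable u \<longleftrightarrow>
     u \<in> borel_measurable lebesgue \<and> (\<forall>K. compact K \<longrightarrow> u absolutely_integrable_on K)"

definition has_weak_deriv ::
  "('n \<Rightarrow> nat) \<Rightarrow> (real^'n \<Rightarrow> real) \<Rightarrow> (real^'n \<Rightarrow> real) \<Rightarrow> bool" where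
  "has_weak_deriv \<alpha> u v \<longleftrightarrow>
     locally_integrable u \<and> locally_integrable v \<and>
     (\<forall>\<phi>. test_function \<phi> \<longrightarrow>
        (LINT x|lebesgue. u x * multi_deriv \<alpha> \<phi> x)
          = (-1) ^ (\<Sum>j\<in>UNIV. \<alpha> j) * (LINT x|lebesgue. v x * \<phi> x))"

text \<open>
  A weak derivative is unique up to null sets, which do not affect any of the norms below.
  The one of order zero is the function itself. If there is no weak derivative, the value is
  meaningless; the spaces below therefore require existence.
\<close>
definition weak_deriv :: "('n \<Rightarrow> nat) \<Rightarrow> (real^'n \<Rightarrow> real) \<Rightarrow> real^'n \<Rightarrow> real" where
  "weak_deriv \<alpha> u = (if \<alpha> = (\<lambda>_. 0) then u else (SOME v. has_weak_deriv \<alpha> u v))"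

text \<open>
  The vector \<open>\<nabla>\<^sup>k u\<close> is the family of the \<open>weak_deriv \<alpha> u\<close>, \<open>\<alpha> \<in> multi_indices k\<close>, with
  the Euclidean norm. As the number of its components varies with \<open>k\<close>, vector-valued functions
  are families \<open>U\<close> of real functions over a finite index set \<open>I\<close>.
\<close>
definition grad_norm :: "nat \<Rightarrow> (real^'n \<Rightarrow> real) \<Rightarrow> real^'n \<Rightarrow> real" where
  "grad_norm k u x = L2_set (\<lambda>\<alpha>. weak_deriv \<alpha> u x) (multi_indices k)"

definition sobolev_space :: "nat \<Rightarrow> (real \<Rightarrow> ennreal) \<Rightarrow> (real^'n \<Rightarrow> real) set" where
  "sobolev_space m A = {u \<in> orlicz_space A.
     \<forall>k\<in>{1..m}. (\<forall>\<alpha>\<in>multi_indices k. \<exists>v. has_weak_deriv \<alpha> u v) \<and>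
                grad_norm k u \<in> orlicz_space A}"

definition sobolev_norm :: "nat \<Rightarrow> (real \<Rightarrow> ennreal) \<Rightarrow> (real^'n \<Rightarrow> real) \<Rightarrow> ennreal" where
  "sobolev_norm m A u = (\<Sum>k=0..m. luxemburg_norm A (grad_norm k u))"

definition frac_seminorm ::
  "real \<Rightarrow> (real \<Rightarrow> ennreal) \<Rightarrow> 'i set \<Rightarrow> ('i \<Rightarrow> real^'n \<Rightarrow> real) \<Rightarrow> ennreal" where
  "frac_seminorm s A I U =
     Inf {ennreal l | l. l > 0 \<and>
       (\<integral>\<^sup>+y. (\<integral>\<^sup>+x. A (L2_set (\<lambda>i. U i x - U i y) I / (l * norm (x - y) powr s))
                 / ennreal (norm (x - y) ^ CARD('n)) \<partial>lebesgue) \<partial>lebesgue) \<le> 1}"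

definition besov_seminorm ::
  "real \<Rightarrow> (real \<Rightarrow> ennreal) \<Rightarrow> 'i set \<Rightarrow> ('i \<Rightarrow> real^'n \<Rightarrow> real) \<Rightarrow> ennreal" where
  "besov_seminorm s A I U =
     Inf {ennreal l | l. l > 0 \<and>
       (\<Sum>j\<in>UNIV. \<integral>\<^sup>+r\<in>{0<..}.
          ((\<integral>\<^sup>+x. A (L2_set (\<lambda>i. U i (x + r *\<^sub>R axis j 1) - U i x) I / (l * r powr s)) \<partial>lebesgue)
             / ennreal r) \<partial>lebesgue) \<le> 1}"

text \<open>
  Below, \<open>nat \<lfloor>s\<rfloor>\<close> is the integer part and \<open>frac s\<close> the fractional part of \<open>s\<close>. Since
  \<open>\<nabla>\<^sup>0 u = u\<close>, the case \<open>0 < s < 1\<close> is covered by the same formulas, as the lemmas at the end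
  confirm.
\<close>
definition frac_sobolev_space :: "real \<Rightarrow> (real \<Rightarrow> ennreal) \<Rightarrow> (real^'n \<Rightarrow> real) set" where
  "frac_sobolev_space s A = {u \<in> sobolev_space (nat \<lfloor>s\<rfloor>) A.
     frac_seminorm (frac s) A (multi_indices (nat \<lfloor>s\<rfloor>)) (\<lambda>\<alpha>. weak_deriv \<alpha> u) < \<infinity>}"

definition frac_sobolev_norm ::
  "real \<Rightarrow> (real \<Rightarrow> ennreal) \<Rightarrow> (real^'n \<Rightarrow> real) \<Rightarrow> ennreal" where
  "frac_sobolev_norm s A u = sobolev_norm (nat \<lfloor>s\<rfloor>) A u
     + frac_seminorm (frac s) A (multi_indices (nat \<lfloor>s\<rfloor>)) (\<lambda>\<alpha>. weak_deriv \<alpha> u)"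

definition besov_space :: "real \<Rightarrow> (real \<Rightarrow> ennreal) \<Rightarrow> (real^'n \<Rightarrow> real) set" where
  "besov_space s A = {u \<in> sobolev_space (nat \<lfloor>s\<rfloor>) A.
     besov_seminorm (frac s) A (multi_indices (nat \<lfloor>s\<rfloor>)) (\<lambda>\<alpha>. weak_deriv \<alpha> u) < \<infinity>}"

definition besov_norm :: "real \<Rightarrow> (real \<Rightarrow> ennreal) \<Rightarrow> (real^'n \<Rightarrow> real) \<Rightarrow> ennreal" where
  "besov_norm s A u = sobolev_norm (nat \<lfloor>s\<rfloor>) A u
     + besov_seminorm (frac s) A (multi_indices (nat \<lfloor>s\<rfloor>)) (\<lambda>\<alpha>. weak_deriv \<alpha> u)"

lemma multi_indices_0: "multi_indices 0 = {\<lambda>_::'n::finite. 0}"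
  by (auto simp: multi_indices_def)

lemma grad_norm_0: "grad_norm 0 u = (\<lambda>x. \<bar>u x\<bar>)"
  by (auto simp: grad_norm_def multi_indices_0 weak_deriv_def L2_set_def)

lemma nat_floor_less_1: "0 < s \<Longrightarrow> s < 1 \<Longrightarrow> nat \<lfloor>s::real\<rfloor> = 0"
  by linarith

lemma frac_less_1: "0 < s \<Longrightarrow> s < 1 \<Longrightarrow> frac (s::real) = s"
  by (simp add: frac_eq)

lemma frac_sobolev_space_less_1:
  assumes "0 < s" "s < 1"
  shows "frac_sobolev_space s A = {u :: real^'n \<Rightarrow> real. u \<in> orlicz_space A \<and>
    Inf {ennreal l | l. l > 0 \<and>
       (\<integral>\<^sup>+y. (\<integral>\<^sup>+x. A (\<bar>u x - u y\<bar> / (l * norm (x - y) powr s))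
                 / ennreal (norm (x - y) ^ CARD('n)) \<partial>lebesgue) \<partial>lebesgue) \<le> 1} < \<infinity>}"
  unfolding frac_sobolev_space_def nat_floor_less_1[OF assms] frac_less_1[OF assms]
    frac_seminorm_def multi_indices_0 sobolev_space_def
  by (simp add: weak_deriv_def L2_set_def)

lemma frac_sobolev_norm_less_1:
  fixes u :: "real^'n \<Rightarrow> real"
  assumes "0 < s" "s < 1"
  shows "frac_sobolev_norm s A u = luxemburg_norm A u +
    Inf {ennreal l | l. l > 0 \<and>
       (\<integral>\<^sup>+y. (\<integral>\<^sup>+x. A (\<bar>u x - u y\<bar> / (l * norm (x - y) powr s))
                 / ennreal (norm (x - y) ^ CARD('n)) \<partial>lebesgue) \<partial>lebesgue) \<le> 1}"
  unfolding frac_sobolev_norm_def nat_floor_less_1[OF assms] frac_less_1[OF assms]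
    frac_seminorm_def multi_indices_0 sobolev_norm_def
  by (simp add: weak_deriv_def L2_set_def grad_norm_0 luxemburg_norm_def)

lemma besov_space_less_1:
  assumes "0 < s" "s < 1"
  shows "besov_space s A = {u \<in> orlicz_space A.
    Inf {ennreal l | l. l > 0 \<and>
       (\<Sum>j\<in>UNIV. \<integral>\<^sup>+r\<in>{0<..}.
          ((\<integral>\<^sup>+x. A (\<bar>u (x + r *\<^sub>R axis j 1) - u x\<bar> / (l * r powr s)) \<partial>lebesgue)
             / ennreal r) \<partial>lebesgue) \<le> 1} < \<infinity>}"
  unfolding besov_space_def nat_floor_less_1[OF assms] frac_less_1[OF assms]
    besov_seminorm_def multi_indices_0 sobolev_space_def
  by (simp add: weak_deriv_def L2_set_def)

lemma besov_norm_less_1: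
  assumes "0 < s" "s < 1"
  shows "besov_norm s A u = luxemburg_norm A u +
    Inf {ennreal l | l. l > 0 \<and>
       (\<Sum>j\<in>UNIV. \<integral>\<^sup>+r\<in>{0<..}.
          ((\<integral>\<^sup>+x. A (\<bar>u (x + r *\<^sub>R axis j 1) - u x\<bar> / (l * r powr s)) \<partial>lebesgue)
             / ennreal r) \<partial>lebesgue) \<le> 1}"
  unfolding besov_norm_def nat_floor_less_1[OF assms] frac_less_1[OF assms]
    besov_seminorm_def multi_indices_0 sobolev_norm_def
  by (simp add: weak_deriv_def L2_set_def grad_norm_0 luxemburg_norm_def)

end

theory Submission imports Defs begin

text \<open>
  Both norms have the same Sobolev part, so everything reduces to comparing the two
  seminorms of the family \<open>U\<close> of the highest weak derivatives. Write
  \<open>G l h = \<integral> A (|U (x + h) - U x| / (l * |h| powr s)) dx\<close>. After the substitution \<open>x = y + h\<close> the modular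
  of the fractional seminorm is \<open>\<integral> G l h / |h| ^ n dh\<close>, and that of the Besov seminorm is
  \<open>\<Sum>j. \<integral>{0<..} G l (r e\<^sub>j) / r dr\<close>.

  For the bound by the Besov modular, an increment by \<open>h\<close> is decomposed into \<open>n\<close> increments along
  the axes. At each point one of these steps is at least as long as the average, hence
  \<open>G (n * l) h \<le> \<Sum>j. G l (h\<^sub>j e\<^sub>j)\<close>. Integrating the kernel \<open>|h| ^ (-n)\<close> over the coordinates other
  than the \<open>j\<close>-th leaves at most a multiple of \<open>1 / |h\<^sub>j|\<close> (\<open>nn_integral_coordinate_le\<close>), and \<open>G l\<close>
  is even.

  Conversely, \<open>U (x + r e\<^sub>j) - U x\<close> is split at the point \<open>x + z\<close>, and the resulting estimate is
  averaged over \<open>z\<close> in the ball with diameter from \<open>0\<close> to \<open>r e\<^sub>j\<close>. There \<open>|z|\<close> and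
  \<open>|r e\<^sub>j - z|\<close> are at most \<open>r\<close>, so \<open>G (2 * l) (r e\<^sub>j)\<close> is at most a multiple of \<open>r ^ (-n)\<close> times the
  integral of \<open>G l\<close> over the ball of radius \<open>r\<close> around \<open>0\<close>. Integration against \<open>dr / r\<close> gives
  the kernel \<open>|h| ^ (-n)\<close> (\<open>radial_layer_cake\<close>).

  All constants depend on \<open>n\<close> alone, because \<open>s\<close> is used only through the monotonicity of
  \<open>t powr s\<close>. Finally \<open>A (t / K) \<le> A t / K\<close> for \<open>K \<ge> 1\<close>, by convexity, moves a constant in front of a
  modular into the parameter \<open>l\<close>, and thus into the seminorm.
\<close>

section \<open>Integrals against homogeneous kernels\<close>

lemma nn_integral_lborel_translate:
  fixes f :: "'a::euclidean_space \<Rightarrow> ennreal"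
  assumes [measurable]: "f \<in> borel_measurable borel"
  shows "(\<integral>\<^sup>+x. f (x + c) \<partial>lborel) = (\<integral>\<^sup>+x. f x \<partial>lborel)"
proof -
  have "(\<integral>\<^sup>+x. f x \<partial>lborel) = (\<integral>\<^sup>+x. f x \<partial>distr lborel borel ((+) c))"
    by (simp add: lborel_distr_plus)
  also have "\<dots> = (\<integral>\<^sup>+x. f (x + c) \<partial>lborel)"
    by (subst nn_integral_distr) (auto simp: add.commute)
  finally show ?thesis by simp
qed

lemma borel_measurable_mono_ennreal:
  fixes A :: "real \<Rightarrow> ennreal"
  assumes "mono A"
  shows "A \<in> borel_measurable borel"
proof (rule borel_measurableI_greater)
  fix c
  have "is_interval {x. c < A x}"
    unfolding is_interval_1 using monoD[OF assms] by (auto intro: less_le_trans)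
  then show "{x \<in> space borel. c < A x} \<in> sets borel"
    by (simp add: real_interval_borel_measurable)
qed

lemma nn_integral_inverse_power_tail:
  assumes "a > 0" "N \<ge> 1"
  shows "(\<integral>\<^sup>+r. ennreal (1 / r ^ Suc N) * indicator {a..} r \<partial>lborel) = ennreal (1 / (real N * a ^ N))"
proof -
  have "(\<integral>\<^sup>+r. ennreal (1 / r ^ Suc N) * indicator {a..} r \<partial>lborel)
      = ennreal (0 - (- (1 / (real N * a ^ N))))"
  proof (rule nn_integral_FTC_atLeast)
    fix x assume "a \<le> x"
    then have x: "x > 0" using assms by simp
    obtain M where M: "N = Suc M" using assms by (cases N) auto
    show "((\<lambda>x. - (1 / (real N * x ^ N))) has_real_derivative 1 / x ^ Suc N) (at x)"
      using x by (auto intro!: derivative_eq_intros simp: M divide_simps) (cases M; simp add: algebra_simps)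
    show "0 \<le> 1 / x ^ Suc N" using x by simp
  next
    have "((\<lambda>x::real. - ((1 / real N) * inverse (x ^ N))) \<longlongrightarrow> - ((1 / real N) * 0)) at_top"
      using assms by (intro tendsto_intros tendsto_inverse_0_at_top filterlim_pow_at_top filterlim_ident) auto
    then show "((\<lambda>x::real. - (1 / (real N * x ^ N))) \<longlongrightarrow> 0) at_top"
      by (simp add: field_simps)
  qed auto
  then show ?thesis by simp
qed

text \<open>
  Tonelli's theorem applied to \<open>|h| ^ (-N) = N * \<integral>{|h|..} r ^ (-N-1) dr\<close>. It turns integrals against
  the singular kernel into integrals over balls, and is used three times: in \<open>\<real>\<^sup>n\<close> for both
  directions of the comparison, and on the line with \<open>N = 1\<close>, where the kernel is the one of
  the Besov modular.
\<close>
lemma radial_layer_cake: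
  fixes G :: "'a::euclidean_space \<Rightarrow> ennreal"
  assumes [measurable]: "G \<in> borel_measurable borel" and N: "N \<ge> 1"
  shows "(\<integral>\<^sup>+h. G h / ennreal (norm h ^ N) \<partial>lborel) =
    of_nat N * (\<integral>\<^sup>+r\<in>{0<..}. (\<integral>\<^sup>+h\<in>cball 0 r. G h \<partial>lborel) / ennreal (r ^ Suc N) \<partial>lborel)"
proof -
  let ?k = "\<lambda>h r. ennreal (1 / r ^ Suc N) * indicator {norm h..} r * indicator {0<..} r"
  have [measurable]: "(\<lambda>(h::'a, r). indicator {norm h..} r :: ennreal) \<in> borel_measurable (borel \<Otimes>\<^sub>M borel)"
    unfolding indicator_def atLeast_iff by measurable
  have inner: "of_nat N * (\<integral>\<^sup>+r. G h * ?k h r \<partial>lborel) = G h / ennreal (norm h ^ N)"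
    if "h \<noteq> 0" for h
  proof -
    have "(\<integral>\<^sup>+r. G h * ?k h r \<partial>lborel) = G h * (\<integral>\<^sup>+r. ?k h r \<partial>lborel)"
      by (rule nn_integral_cmult) measurable
    also have "(\<integral>\<^sup>+r. ?k h r \<partial>lborel) = (\<integral>\<^sup>+r. ennreal (1 / r ^ Suc N) * indicator {norm h..} r \<partial>lborel)"
    proof (rule nn_integral_cong)
      have "0 < r" if "norm h \<le> r" for r
        using that \<open>h \<noteq> 0\<close> by (metis zero_less_norm_iff order.strict_trans2)
      then show "?k h r = ennreal (1 / r ^ Suc N) * indicator {norm h..} r" for r
        by (auto simp: indicator_def)
    qed
    also have "\<dots> = ennreal (1 / (real N * norm h ^ N))"
      using that N by (intro nn_integral_inverse_power_tail) auto
    also have "of_nat N * (G h * \<dots>) = G h * (ennreal (real N) * ennreal (1 / (real N * norm h ^ N)))"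
      by (simp add: ennreal_of_nat_eq_real_of_nat mult_ac)
    also have "ennreal (real N) * ennreal (1 / (real N * norm h ^ N)) = inverse (ennreal (norm h ^ N))"
      using that N by (subst ennreal_mult'[symmetric]) (auto simp: inverse_ennreal divide_simps)
    finally show ?thesis by (simp add: divide_ennreal_def)
  qed
  have "(\<integral>\<^sup>+h. G h / ennreal (norm h ^ N) \<partial>lborel) =
     (\<integral>\<^sup>+h. of_nat N * (\<integral>\<^sup>+r. G h * ?k h r \<partial>lborel) \<partial>lborel)"
    by (intro nn_integral_cong_AE eventually_mono[OF AE_lborel_singleton[of 0]] inner[symmetric])
  also have "\<dots> = of_nat N * (\<integral>\<^sup>+h. \<integral>\<^sup>+r. G h * ?k h r \<partial>lborel \<partial>lborel)"
    by (rule nn_integral_cmult) measurable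
  also have "(\<integral>\<^sup>+h. \<integral>\<^sup>+r. G h * ?k h r \<partial>lborel \<partial>lborel) = (\<integral>\<^sup>+r. \<integral>\<^sup>+h. G h * ?k h r \<partial>lborel \<partial>lborel)"
    by (rule lborel_pair.Fubini') measurable
  also have "\<dots> = (\<integral>\<^sup>+r\<in>{0<..}. (\<integral>\<^sup>+h\<in>cball 0 r. G h \<partial>lborel) / ennreal (r ^ Suc N) \<partial>lborel)"
  proof (intro nn_integral_cong)
    fix r :: real
    have [measurable]: "cball (0::'a) r \<in> sets borel" by simp
    show "(\<integral>\<^sup>+h. G h * ?k h r \<partial>lborel) =
      (\<integral>\<^sup>+h\<in>cball 0 r. G h \<partial>lborel) / ennreal (r ^ Suc N) * indicator {0<..} r"
    proof (cases "r > 0")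
      case True
      have "(\<integral>\<^sup>+h. G h * ?k h r \<partial>lborel) =
        (\<integral>\<^sup>+h. G h * indicator (cball 0 r) h / ennreal (r ^ Suc N) \<partial>lborel)"
        using True by (intro nn_integral_cong)
          (auto simp: indicator_def divide_ennreal_def inverse_ennreal inverse_eq_divide)
      also have "\<dots> = (\<integral>\<^sup>+h\<in>cball 0 r. G h \<partial>lborel) / ennreal (r ^ Suc N)"
        by (rule nn_integral_divide) measurable
      finally show ?thesis using True by simp
    qed simp
  qed
  finally show ?thesis .
qed

text \<open>
  The ball lies in the cube of the same radius, and over the cube Tonelli's theorem
  splits off the other coordinates; each of them contributes the side length \<open>2 * r\<close>.
\<close>
lemma nn_integral_coordinate_slab:
  fixes F :: "real \<Rightarrow> ennreal" and j :: "'n::finite"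
  assumes [measurable]: "F \<in> borel_measurable borel" and "r > 0"
  shows "(\<integral>\<^sup>+h\<in>cball (0::real^'n) r. F (h $ j) \<partial>lborel) \<le>
    ennreal ((2 * r) ^ (CARD('n) - 1)) * (\<integral>\<^sup>+t\<in>cball 0 r. F t \<partial>lborel)"
proof -
  let ?e = "axis j 1 :: real^'n"
  define f where "f b t = (if b = ?e then F t else 1) * indicator {-r..r} t" for b and t :: real
  have e: "?e \<in> Basis" by (simp add: axis_in_Basis_iff)
  have "F (h $ j) * indicator (cball 0 r) h \<le> (\<Prod>b\<in>Basis. f b (h \<bullet> b))" for h :: "real^'n"
  proof (cases "norm h \<le> r")
    case True
    have *: "indicator {-r..r} (h \<bullet> b) = (1::ennreal)" if "b \<in> Basis" for b
      using Basis_le_norm[OF that, of h] True by (auto simp: indicator_def)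
    have "(\<Prod>b\<in>Basis. f b (h \<bullet> b)) = (\<Prod>b\<in>Basis. if b = ?e then F (h \<bullet> b) else 1)"
      using * by (intro prod.cong) (auto simp: f_def)
    also have "\<dots> = F (h $ j)"
      using e by (subst prod.delta) (auto simp: inner_axis)
    finally show ?thesis by (auto simp: indicator_def)
  qed (auto simp: indicator_def)
  then have "(\<integral>\<^sup>+h\<in>cball (0::real^'n) r. F (h $ j) \<partial>lborel)
      \<le> (\<integral>\<^sup>+h. (\<Prod>b\<in>Basis. f b (h \<bullet> b)) \<partial>lborel)"
    by (intro nn_integral_mono)
  also have "\<dots> = (\<Prod>b\<in>(Basis :: (real^'n) set). \<integral>\<^sup>+t. f b t \<partial>lborel)"
    unfolding f_def by (rule nn_integral_lborel_prod) auto
  also have "\<dots> = (\<integral>\<^sup>+t. f ?e t \<partial>lborel) * (\<Prod>b\<in>(Basis :: (real^'n) set) - {?e}. \<integral>\<^sup>+t. f b t \<partial>lborel)"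
    using e by (intro prod.remove) auto
  also have "(\<integral>\<^sup>+t. f ?e t \<partial>lborel) = (\<integral>\<^sup>+t\<in>cball 0 r. F t \<partial>lborel)"
    by (intro nn_integral_cong) (auto simp: f_def indicator_def)
  also have "(\<Prod>b\<in>(Basis :: (real^'n) set) - {?e}. \<integral>\<^sup>+t. f b t \<partial>lborel)
      = (\<Prod>b\<in>(Basis :: (real^'n) set) - {?e}. ennreal (2 * r))"
    using assms(2) by (intro prod.cong) (auto simp: f_def)
  also have "\<dots> = ennreal ((2 * r) ^ (CARD('n) - 1))"
    using e assms(2) by (simp add: card_Diff_singleton ennreal_power)
  finally show ?thesis by (simp add: mult.commute)
qed

text \<open>
  The measure \<open>|h| ^ (-n) dh\<close> is invariant under dilations, hence so is its image under a
  coordinate projection, which must then be a multiple of \<open>dt / |t|\<close>. Only an upper bound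
  for the multiple is needed. The layer cake formula gives one: the factor \<open>r ^ (n - 1)\<close> lost in a
  slab turns the weight \<open>r ^ (-n-1)\<close> into \<open>r ^ (-2)\<close>, which belongs to the kernel \<open>1 / |t|\<close> on
  the line.
\<close>
lemma nn_integral_coordinate_le:
  fixes F :: "real \<Rightarrow> ennreal" and j :: "'n::finite"
  assumes [measurable]: "F \<in> borel_measurable borel"
  shows "(\<integral>\<^sup>+h. F (h $ j) / ennreal (norm h ^ CARD('n)) \<partial>(lborel :: (real^'n) measure)) \<le>
    ennreal (real CARD('n) * 2 ^ (CARD('n) - 1)) * (\<integral>\<^sup>+t. F t / ennreal \<bar>t\<bar> \<partial>lborel)"
proof -
  let ?n = "CARD('n)"
  let ?I = "\<lambda>r. \<integral>\<^sup>+t\<in>cball 0 r. F t \<partial>lborel"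
  have n: "?n \<ge> 1" by (simp add: Suc_leI)
  have [measurable]: "(\<lambda>(r, t::real). indicator (cball 0 r) t :: ennreal) \<in> borel_measurable (borel \<Otimes>\<^sub>M borel)"
    unfolding indicator_def by (simp add: cball_def) measurable
  have "(\<integral>\<^sup>+h. F (h $ j) / ennreal (norm h ^ ?n) \<partial>(lborel :: (real^'n) measure)) =
    of_nat ?n * (\<integral>\<^sup>+r\<in>{0<..}. (\<integral>\<^sup>+h\<in>cball (0::real^'n) r. F (h $ j) \<partial>lborel) / ennreal (r ^ Suc ?n) \<partial>lborel)"
    using n by (intro radial_layer_cake) (auto intro: measurable_compose[OF _ assms])
  also have "\<dots> \<le> of_nat ?n * (\<integral>\<^sup>+r. ennreal (2 ^ (?n - 1)) *
      (?I r / ennreal (r ^ Suc 1) * indicator {0<..} r) \<partial>lborel)"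
  proof (intro mult_left_mono nn_integral_mono)
    fix r :: real
    show "(\<integral>\<^sup>+h\<in>cball (0::real^'n) r. F (h $ j) \<partial>lborel) / ennreal (r ^ Suc ?n) * indicator {0<..} r
      \<le> ennreal (2 ^ (?n - 1)) * (?I r / ennreal (r ^ Suc 1) * indicator {0<..} r)"
    proof (cases "r > 0")
      case True
      have "(\<integral>\<^sup>+h\<in>cball (0::real^'n) r. F (h $ j) \<partial>lborel) / ennreal (r ^ Suc ?n)
        \<le> ennreal ((2 * r) ^ (?n - 1)) * ?I r / ennreal (r ^ Suc ?n)"
        using True by (intro divide_right_mono_ennreal nn_integral_coordinate_slab) auto
      also have "\<dots> = (ennreal ((2 * r) ^ (?n - 1)) * ennreal (1 / r ^ Suc ?n)) * ?I r"
        using True by (simp add: divide_ennreal_def inverse_ennreal inverse_eq_divide mult_ac)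
      also have "ennreal ((2 * r) ^ (?n - 1)) * ennreal (1 / r ^ Suc ?n)
          = ennreal (2 ^ (?n - 1)) * ennreal (1 / r ^ Suc 1)"
      proof -
        obtain m where m: "?n = Suc m" using n by (cases ?n) auto
        show ?thesis using True unfolding m
          by (simp add: ennreal_mult'[symmetric] power_mult_distrib divide_simps)
      qed
      finally show ?thesis using True
        by (simp add: divide_ennreal_def inverse_ennreal inverse_eq_divide mult_ac)
    qed simp
  qed simp
  also have "\<dots> = of_nat ?n * (ennreal (2 ^ (?n - 1)) *
      (\<integral>\<^sup>+r\<in>{0<..}. ?I r / ennreal (r ^ Suc 1) \<partial>lborel))"
    by (subst nn_integral_cmult) auto
  also have "(\<integral>\<^sup>+r\<in>{0<..}. ?I r / ennreal (r ^ Suc 1) \<partial>lborel) = (\<integral>\<^sup>+t. F t / ennreal \<bar>t\<bar> \<partial>lborel)"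
    using radial_layer_cake[of F 1] by simp
  finally show ?thesis
    by (simp add: ennreal_mult ennreal_of_nat_eq_real_of_nat mult.assoc)
qed

section \<open>Comparison of the two modulars\<close>

text \<open>
  A vector-valued function \<open>U\<close> enters the modulars only through \<open>|U x - U y|\<close>, so all
  estimates are made for a Borel measurable pseudo-distance \<open>d\<close>. Of the convexity of \<open>A\<close> they
  use only monotonicity and the contraction property \<open>A_contract\<close>; the latter enters when a
  constant in front of a modular is absorbed into the parameter \<open>l\<close>.
\<close>
locale modulated_distance =
  fixes A :: "real \<Rightarrow> ennreal" and d :: "real^'n::finite \<Rightarrow> real^'n \<Rightarrow> real" and s :: real
  assumes A_mono: "mono A"
    and A_zero: "A 0 = 0"
    and A_contract: "1 \<le> K \<Longrightarrow> 0 \<le> t \<Longrightarrow> A (t / K) \<le> A t / ennreal K"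
    and d_borel: "case_prod d \<in> borel_measurable (borel \<Otimes>\<^sub>M borel)"
    and d_nonneg: "0 \<le> d x y"
    and d_self: "d x x = 0"
    and d_sym: "d x y = d y x"
    and d_triangle: "d x z \<le> d x y + d y z"
    and s_nonneg: "0 \<le> s"
begin

definition increment_modular :: "real \<Rightarrow> real^'n \<Rightarrow> ennreal" where
  "increment_modular l h = (\<integral>\<^sup>+x. A (d (x + h) x / (l * norm h powr s)) \<partial>lborel)"

text \<open>
  The modular of the fractional seminorm after the substitution \<open>x = y + h\<close>.
\<close>
definition gagliardo_modular :: "real \<Rightarrow> ennreal" where
  "gagliardo_modular l = (\<integral>\<^sup>+h. increment_modular l h / ennreal (norm h ^ CARD('n)) \<partial>lborel)"

definition axis_modular :: "real \<Rightarrow> ennreal" where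
  "axis_modular l =
     (\<Sum>j\<in>UNIV. \<integral>\<^sup>+r\<in>{0<..}. increment_modular l (r *\<^sub>R axis j 1) / ennreal r \<partial>lborel)"

lemma A_borel [measurable]: "A \<in> borel_measurable borel"
  by (rule borel_measurable_mono_ennreal[OF A_mono])

lemma d_measurable [measurable (raw)]:
  assumes [measurable]: "f \<in> borel_measurable M" "g \<in> borel_measurable M"
  shows "(\<lambda>x. d (f x) (g x)) \<in> borel_measurable M"
  using measurable_compose[OF measurable_Pair[OF assms] d_borel] by simp

lemma increment_modular_borel [measurable]: "increment_modular l \<in> borel_measurable borel"
  unfolding increment_modular_def by measurable

lemma increment_modular_uminus: "increment_modular l (- h) = increment_modular l h"
proof -
  have "increment_modular l (- h) =
      (\<integral>\<^sup>+x. A (d (x + h + - h) (x + h) / (l * norm (- h) powr s)) \<partial>lborel)"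
    unfolding increment_modular_def
    by (rule nn_integral_lborel_translate[symmetric]) measurable
  then show ?thesis
    by (simp add: increment_modular_def d_sym)
qed

text \<open>
  Replacing an increment by a shorter one only increases the quotient. For the zero
  increment division yields \<open>0\<close>, which is harmless as soon as the distance vanishes too.
\<close>
lemma A_quotient_mono:
  assumes "D \<le> c * D'" "0 \<le> D'" "norm h' \<le> norm h" "h' = 0 \<Longrightarrow> D' = 0" "c > 0" "l > 0"
  shows "A (D / (c * l * norm h powr s)) \<le> A (D' / (l * norm h' powr s))"
proof (rule monoD[OF A_mono])
  show "D / (c * l * norm h powr s) \<le> D' / (l * norm h' powr s)"
  proof (cases "h' = 0")
    case True
    then have "D \<le> 0" using assms by simp
    moreover have "0 \<le> c * l * norm h powr s" using assms by simp
    ultimately show ?thesis using True assms(4) by (simp add: divide_nonpos_nonneg)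
  next
    case False
    then have pos: "0 < norm h' powr s" and le: "norm h' powr s \<le> norm h powr s"
      using assms s_nonneg by (auto intro: powr_mono2)
    have "D / (c * l * norm h powr s) \<le> c * D' / (c * l * norm h powr s)"
      using assms by (intro divide_right_mono) auto
    also have "\<dots> = D' / (l * norm h powr s)" using assms by simp
    also have "\<dots> \<le> D' / (l * norm h' powr s)"
      using assms pos le by (intro divide_left_mono mult_left_mono mult_pos_pos) auto
    finally show ?thesis .
  qed
qed

lemma increment_modular_contract:
  assumes "K \<ge> 1" "l > 0"
  shows "increment_modular (K * l) h \<le> increment_modular l h / ennreal K"
proof -
  have "increment_modular (K * l) h \<le>
      (\<integral>\<^sup>+x. A (d (x + h) x / (l * norm h powr s)) / ennreal K \<partial>lborel)"
    unfolding increment_modular_def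
  proof (rule nn_integral_mono)
    fix x
    have "A (d (x + h) x / (l * norm h powr s) / K) \<le> A (d (x + h) x / (l * norm h powr s)) / ennreal K"
      using assms d_nonneg by (intro A_contract) auto
    then show "A (d (x + h) x / (K * l * norm h powr s)) \<le> A (d (x + h) x / (l * norm h powr s)) / ennreal K"
      by (simp add: mult_ac)
  qed
  also have "\<dots> = increment_modular l h / ennreal K"
    unfolding increment_modular_def by (rule nn_integral_divide) measurable
  finally show ?thesis .
qed

lemma increment_modular_contract_divide:
  assumes "K \<ge> 1" "l > 0"
  shows "increment_modular (K * l) h / c \<le> increment_modular l h / c / ennreal K"
  using divide_right_mono_ennreal[OF increment_modular_contract[OF assms], of h c]
  by (simp add: divide_ennreal_def mult_ac)

lemma gagliardo_modular_contract:
  assumes "K \<ge> 1" "l > 0"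
  shows "gagliardo_modular (K * l) \<le> gagliardo_modular l / ennreal K"
proof -
  have "gagliardo_modular (K * l) \<le>
      (\<integral>\<^sup>+h. increment_modular l h / ennreal (norm h ^ CARD('n)) / ennreal K \<partial>lborel)"
    unfolding gagliardo_modular_def
    by (intro nn_integral_mono increment_modular_contract_divide assms)
  also have "\<dots> = gagliardo_modular l / ennreal K"
    unfolding gagliardo_modular_def by (rule nn_integral_divide) measurable
  finally show ?thesis .
qed

lemma axis_modular_contract:
  assumes "K \<ge> 1" "l > 0"
  shows "axis_modular (K * l) \<le> axis_modular l / ennreal K"
proof -
  have "axis_modular (K * l) \<le> (\<Sum>j\<in>UNIV. \<integral>\<^sup>+r.
      increment_modular l (r *\<^sub>R axis j 1) / ennreal r * indicator {0<..} r / ennreal K \<partial>lborel)"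
    unfolding axis_modular_def
    using increment_modular_contract_divide[OF assms]
    by (intro sum_mono nn_integral_mono) (simp split: split_indicator)
  also have "\<dots> = (\<Sum>j\<in>UNIV. (\<integral>\<^sup>+r\<in>{0<..}.
      increment_modular l (r *\<^sub>R axis j 1) / ennreal r \<partial>lborel) / ennreal K)"
    by (intro sum.cong refl nn_integral_divide) measurable
  also have "\<dots> = axis_modular l / ennreal K"
    unfolding axis_modular_def by (simp add: divide_ennreal_def sum_distrib_right)
  finally show ?thesis .
qed

text \<open>
  Walking from \<open>x\<close> to \<open>x + h\<close> along the coordinate directions: the \<open>j\<close>-th step
  starts at \<open>x + p j\<close>. The offsets \<open>p\<close> depend on \<open>h\<close> but not on \<open>x\<close>, so that after
  integration over \<open>x\<close> they disappear by translation invariance.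
\<close>
lemma distance_le_coordinate_steps:
  fixes h :: "real^'n"
  assumes "finite J"
  shows "\<exists>p. \<forall>x. d (x + (\<Sum>j\<in>J. h $ j *\<^sub>R axis j 1)) x \<le>
    (\<Sum>j\<in>J. d (x + p j + h $ j *\<^sub>R axis j 1) (x + p j))"
  using assms
proof (induction J)
  case empty
  then show ?case by (simp add: d_self)
next
  case (insert k J)
  then obtain p where p: "\<And>x. d (x + (\<Sum>j\<in>J. h $ j *\<^sub>R axis j 1)) x \<le>
    (\<Sum>j\<in>J. d (x + p j + h $ j *\<^sub>R axis j 1) (x + p j))" by auto
  define q :: "real^'n" where "q = (\<Sum>j\<in>J. h $ j *\<^sub>R axis j 1)"
  have "d (x + (\<Sum>j\<in>insert k J. h $ j *\<^sub>R axis j 1)) x \<le>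
    (\<Sum>j\<in>insert k J. d (x + (p(k := q)) j + h $ j *\<^sub>R axis j 1) (x + (p(k := q)) j))" for x
  proof -
    have "d (x + (\<Sum>j\<in>insert k J. h $ j *\<^sub>R axis j 1)) x \<le>
      d (x + q + h $ k *\<^sub>R axis k 1) (x + q) + d (x + q) x"
      using insert.hyps d_triangle[of "x + q + h $ k *\<^sub>R axis k 1" x "x + q"]
      by (simp add: q_def add_ac)
    also have "\<dots> \<le> d (x + q + h $ k *\<^sub>R axis k 1) (x + q) +
      (\<Sum>j\<in>J. d (x + p j + h $ j *\<^sub>R axis j 1) (x + p j))"
      using p[of x] by (simp add: q_def)
    also have "(\<Sum>j\<in>J. d (x + p j + h $ j *\<^sub>R axis j 1) (x + p j)) =
      (\<Sum>j\<in>J. d (x + (p(k := q)) j + h $ j *\<^sub>R axis j 1) (x + (p(k := q)) j))"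
      using insert.hyps by (intro sum.cong) auto
    finally show ?thesis using insert.hyps by simp
  qed
  then show ?case by blast
qed

text \<open>
  At every \<open>x\<close>, one of the \<open>n\<close> steps is at least as long as the average; the
  corresponding summand alone dominates the left-hand side.
\<close>
lemma increment_modular_le_axes:
  assumes "l > 0"
  shows "increment_modular (real CARD('n) * l) h \<le>
    (\<Sum>j\<in>UNIV. increment_modular l (h $ j *\<^sub>R axis j 1))"
proof -
  let ?e = "\<lambda>j. h $ j *\<^sub>R axis j 1 :: real^'n"
  have h: "(\<Sum>j\<in>UNIV. ?e j) = h"
    by (simp add: vec_eq_iff axis_def if_distrib cong: if_cong)
  obtain p where p: "\<And>x. d (x + h) x \<le> (\<Sum>j\<in>UNIV. d (x + p j + ?e j) (x + p j))"
    using distance_le_coordinate_steps[of UNIV h] unfolding h by auto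
  have "increment_modular (real CARD('n) * l) h \<le>
      (\<integral>\<^sup>+x. (\<Sum>j\<in>UNIV. A (d (x + p j + ?e j) (x + p j) / (l * norm (?e j) powr s))) \<partial>lborel)"
    unfolding increment_modular_def
  proof (rule nn_integral_mono)
    fix x
    have "\<exists>j. d (x + h) x \<le> real CARD('n) * d (x + p j + ?e j) (x + p j)"
    proof (rule ccontr)
      assume "\<not> ?thesis"
      then have "(\<Sum>j\<in>(UNIV :: 'n set). real CARD('n) * d (x + p j + ?e j) (x + p j)) <
          (\<Sum>j\<in>(UNIV :: 'n set). d (x + h) x)"
        by (intro sum_strict_mono) (auto simp: not_le)
      then show False
        using p[of x] by (simp flip: sum_distrib_left)
    qed
    then obtain j where j: "d (x + h) x \<le> real CARD('n) * d (x + p j + ?e j) (x + p j)" ..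
    have "A (d (x + h) x / (real CARD('n) * l * norm h powr s)) \<le>
        A (d (x + p j + ?e j) (x + p j) / (l * norm (?e j) powr s))"
      using j assms component_le_norm_cart[of h j]
      by (intro A_quotient_mono) (auto simp: d_nonneg d_self)
    also have "\<dots> \<le> (\<Sum>j\<in>UNIV. A (d (x + p j + ?e j) (x + p j) / (l * norm (?e j) powr s)))"
      by (rule member_le_sum) auto
    finally show "A (d (x + h) x / (real CARD('n) * l * norm h powr s)) \<le> \<dots>" .
  qed
  also have "\<dots> = (\<Sum>j\<in>UNIV. \<integral>\<^sup>+x. A (d (x + p j + ?e j) (x + p j) / (l * norm (?e j) powr s)) \<partial>lborel)"
    by (rule nn_integral_sum) measurable
  also have "\<dots> = (\<Sum>j\<in>UNIV. increment_modular l (?e j))"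
    unfolding increment_modular_def
    by (intro sum.cong refl nn_integral_lborel_translate) measurable
  finally show ?thesis .
qed

lemma nn_integral_increment_axis:
  "(\<integral>\<^sup>+t. increment_modular l (t *\<^sub>R axis j 1) / ennreal \<bar>t\<bar> \<partial>lborel) =
    2 * (\<integral>\<^sup>+r\<in>{0<..}. increment_modular l (r *\<^sub>R axis j 1) / ennreal r \<partial>lborel)"
proof -
  define F where "F t = increment_modular l (t *\<^sub>R axis j 1) / ennreal \<bar>t\<bar>" for t
  have [measurable]: "F \<in> borel_measurable borel" unfolding F_def by measurable
  have even: "F (- t) = F t" for t
    using increment_modular_uminus[of l "t *\<^sub>R axis j 1"] by (simp add: F_def)
  have "(\<integral>\<^sup>+t. F t \<partial>lborel) = (\<integral>\<^sup>+t. F t * indicator {0<..} t + F t * indicator {..<0} t \<partial>lborel)"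
    by (intro nn_integral_cong_AE eventually_mono[OF AE_lborel_singleton[of 0]])
      (auto simp: indicator_def)
  also have "\<dots> = (\<integral>\<^sup>+t\<in>{0<..}. F t \<partial>lborel) + (\<integral>\<^sup>+t\<in>{..<0}. F t \<partial>lborel)"
    by (rule nn_integral_add) measurable
  also have "(\<integral>\<^sup>+t\<in>{..<0}. F t \<partial>lborel) = (\<integral>\<^sup>+t\<in>{0<..}. F t \<partial>lborel)"
    by (subst nn_integral_real_affine[of _ "-1" 0])
      (auto simp: even indicator_def intro!: nn_integral_cong)
  also have "(\<integral>\<^sup>+t\<in>{0<..}. F t \<partial>lborel) =
      (\<integral>\<^sup>+r\<in>{0<..}. increment_modular l (r *\<^sub>R axis j 1) / ennreal r \<partial>lborel)"
    by (intro nn_integral_cong) (auto simp: F_def indicator_def)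
  finally show ?thesis by (simp add: F_def mult_2)
qed

text \<open>
  Each summand of \<open>increment_modular_le_axes\<close> depends on one coordinate of \<open>h\<close> only;
  the others are integrated out.
\<close>
lemma gagliardo_modular_le_axis_modular:
  assumes "l > 0"
  shows "gagliardo_modular (real CARD('n) * l) \<le> ennreal (real CARD('n) * 2 ^ CARD('n)) * axis_modular l"
proof -
  let ?n = "CARD('n)"
  have n: "2 * (2::real) ^ (?n - 1) = 2 ^ ?n"
    by (simp flip: power_Suc)
  have "gagliardo_modular (real ?n * l) \<le>
      (\<integral>\<^sup>+h. (\<Sum>j\<in>UNIV. increment_modular l (h $ j *\<^sub>R axis j 1) / ennreal (norm h ^ ?n)) \<partial>lborel)"
    unfolding gagliardo_modular_def
  proof (rule nn_integral_mono)
    fix h :: "real^'n"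
    show "increment_modular (real ?n * l) h / ennreal (norm h ^ ?n) \<le>
      (\<Sum>j\<in>UNIV. increment_modular l (h $ j *\<^sub>R axis j 1) / ennreal (norm h ^ ?n))"
      using divide_right_mono_ennreal[OF increment_modular_le_axes[OF assms, of h], of "ennreal (norm h ^ ?n)"]
      by (simp add: divide_ennreal_def sum_distrib_right)
  qed
  also have "\<dots> = (\<Sum>j\<in>UNIV. \<integral>\<^sup>+h. increment_modular l (h $ j *\<^sub>R axis j 1) / ennreal (norm h ^ ?n) \<partial>lborel)"
    by (rule nn_integral_sum) measurable
  also have "\<dots> \<le> (\<Sum>j\<in>UNIV. ennreal (real ?n * 2 ^ (?n - 1)) *
      (2 * (\<integral>\<^sup>+r\<in>{0<..}. increment_modular l (r *\<^sub>R axis j 1) / ennreal r \<partial>lborel)))"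
    unfolding nn_integral_increment_axis[symmetric]
    by (intro sum_mono nn_integral_coordinate_le[where F = "\<lambda>t. increment_modular l (t *\<^sub>R axis _ 1)"]) measurable
  also have "\<dots> = ennreal (real ?n * 2 ^ (?n - 1)) * 2 * axis_modular l"
    unfolding axis_modular_def by (simp add: sum_distrib_left mult_ac)
  also have "ennreal (real ?n * 2 ^ (?n - 1)) * 2 = ennreal (real ?n * 2 ^ (?n - 1)) * ennreal 2"
    by simp
  also have "\<dots> = ennreal (real ?n * 2 ^ ?n)"
    unfolding n[symmetric] by (subst ennreal_mult'[symmetric]) (auto simp: mult_ac)
  finally show ?thesis .
qed

text \<open>
  Passing through the intermediate point \<open>x + a\<close>, one of the two pieces is at least half
  as long as the whole.
\<close>
lemma increment_modular_add:
  assumes "l > 0" "norm a \<le> norm (a + b)" "norm b \<le> norm (a + b)"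
  shows "increment_modular (2 * l) (a + b) \<le> increment_modular l a + increment_modular l b"
proof -
  let ?Q = "\<lambda>h x. A (d (x + h) x / (l * norm h powr s))"
  have "increment_modular (2 * l) (a + b) \<le> (\<integral>\<^sup>+x. ?Q a x + ?Q b (x + a) \<partial>lborel)"
    unfolding increment_modular_def
  proof (rule nn_integral_mono)
    fix x
    let ?L = "A (d (x + (a + b)) x / (2 * l * norm (a + b) powr s))"
    have "d (x + (a + b)) x \<le> d (x + a) x + d (x + a + b) (x + a)"
      using d_triangle[of "x + (a + b)" x "x + a"] by (simp add: add_ac)
    then consider "d (x + (a + b)) x \<le> 2 * d (x + a) x"
      | "d (x + (a + b)) x \<le> 2 * d (x + a + b) (x + a)"
      by linarith
    then have "?L \<le> ?Q a x \<or> ?L \<le> ?Q b (x + a)"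
    proof cases
      case 1
      then have "?L \<le> ?Q a x"
        using assms by (intro A_quotient_mono) (auto simp: d_nonneg d_self)
      then show ?thesis ..
    next
      case 2
      then have "?L \<le> ?Q b (x + a)"
        using assms by (intro A_quotient_mono) (auto simp: d_nonneg d_self)
      then show ?thesis ..
    qed
    then show "?L \<le> ?Q a x + ?Q b (x + a)"
      by (auto intro: add_increasing add_increasing2)
  qed
  also have "\<dots> = (\<integral>\<^sup>+x. ?Q a x \<partial>lborel) + (\<integral>\<^sup>+x. ?Q b (x + a) \<partial>lborel)"
    by (rule nn_integral_add) measurable
  also have "(\<integral>\<^sup>+x. ?Q b (x + a) \<partial>lborel) = (\<integral>\<^sup>+x. ?Q b x \<partial>lborel)"
    by (rule nn_integral_lborel_translate) measurable
  finally show ?thesis by (simp add: increment_modular_def)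
qed

text \<open>
  An increment along an axis is split at \<open>x + z\<close>, where \<open>z\<close> ranges over the ball whose
  diameter is the segment from \<open>0\<close> to \<open>r *\<^sub>R axis j 1\<close>. For such \<open>z\<close> neither piece is longer than
  \<open>r\<close>, so integration over \<open>z\<close> bounds the increment by its average over all
  directions.
\<close>
lemma increment_modular_axis_le_average:
  assumes "l > 0" "r > 0"
  shows "ennreal (unit_ball_vol CARD('n) * (r / 2) ^ CARD('n)) *
      increment_modular (2 * l) (r *\<^sub>R axis j 1) \<le>
    2 * (\<integral>\<^sup>+h\<in>cball 0 r. increment_modular l h \<partial>lborel)"
proof -
  define v :: "real^'n" where "v = r *\<^sub>R axis j 1"
  define c where "c = v /\<^sub>R 2"
  define f where "f z = increment_modular l z * indicator (cball 0 r) z" for z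
  have [measurable]: "cball (0 :: real^'n) r \<in> sets borel" by simp
  have f [measurable]: "f \<in> borel_measurable borel" unfolding f_def by measurable
  have v: "norm v = r" using assms by (simp add: v_def)
  have "ennreal (unit_ball_vol CARD('n) * (r / 2) ^ CARD('n)) = emeasure lborel (ball c (r / 2))"
    using assms by (subst emeasure_ball) auto
  also have "\<dots> * increment_modular (2 * l) v =
      (\<integral>\<^sup>+z. increment_modular (2 * l) v * indicator (ball c (r / 2)) z \<partial>lborel)"
    by (subst nn_integral_cmult_indicator) (auto simp: mult.commute)
  also have "\<dots> \<le> (\<integral>\<^sup>+z. f z + f (z + - v) \<partial>lborel)"
  proof (rule nn_integral_mono)
    fix z
    show "increment_modular (2 * l) v * indicator (ball c (r / 2)) z \<le> f z + f (z + - v)"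
    proof (cases "z \<in> ball c (r / 2)")
      case True
      then have zc: "norm (z - c) \<le> r / 2" by (simp add: dist_norm norm_minus_commute)
      have nc: "norm c = r / 2" using v assms by (simp add: c_def)
      have nz: "norm z \<le> r"
        using norm_triangle_ineq[of "z - c" c] zc nc unfolding diff_add_cancel by linarith
      have nzv: "norm (z - v) \<le> r"
      proof -
        have "z - v = (z - c) - c"
          by (simp add: c_def vec_eq_iff)
        then have "norm (z - v) \<le> norm (z - c) + norm c"
          by (metis norm_triangle_ineq4)
        then show ?thesis using zc nc by linarith
      qed
      have "increment_modular (2 * l) v = increment_modular (2 * l) (z + (v - z))"
        by simp
      also have "\<dots> \<le> increment_modular l z + increment_modular l (v - z)"
        using assms(1) by (rule increment_modular_add) (use v nz nzv in \<open>simp_all add: norm_minus_commute[of v]\<close>)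
      also have "increment_modular l (v - z) = increment_modular l (z + - v)"
        using increment_modular_uminus[of l "z - v"] by simp
      also have "increment_modular l z + \<dots> = f z + f (z + - v)"
        using nz nzv by (simp add: f_def)
      finally show ?thesis using True by simp
    qed simp
  qed
  also have "\<dots> = (\<integral>\<^sup>+z. f z \<partial>lborel) + (\<integral>\<^sup>+z. f (z + - v) \<partial>lborel)"
    by (rule nn_integral_add) (auto intro: measurable_compose[OF _ f])
  also have "(\<integral>\<^sup>+z. f (z + - v) \<partial>lborel) = (\<integral>\<^sup>+z. f z \<partial>lborel)"
    by (rule nn_integral_lborel_translate[OF f])
  finally show ?thesis by (simp only: v_def f_def mult_2)
qed

text \<open>
  After division by the volume of the ball in the preceding estimate, the weight is
  \<open>r ^ (-n-1)\<close>, and the layer cake formula recovers the kernel \<open>|h| ^ (-n)\<close>.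
\<close>
lemma axis_modular_le_gagliardo_modular:
  assumes "l > 0"
  shows "axis_modular (2 * l) \<le>
    ennreal (2 ^ Suc CARD('n) / unit_ball_vol CARD('n)) * gagliardo_modular l"
proof -
  let ?n = "CARD('n)"
  let ?c = "2 ^ Suc ?n / unit_ball_vol ?n"
  let ?I = "\<lambda>r. \<integral>\<^sup>+h\<in>cball 0 r. increment_modular l h \<partial>lborel"
  have w: "unit_ball_vol ?n > 0" by simp
  have [measurable]: "(\<lambda>(r, h::real^'n). indicator (cball 0 r) h :: ennreal) \<in> borel_measurable (borel \<Otimes>\<^sub>M borel)"
    unfolding indicator_def by (simp add: cball_def) measurable
  have "axis_modular (2 * l) \<le> (\<Sum>j\<in>(UNIV :: 'n set). \<integral>\<^sup>+r. ennreal ?c *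
      (?I r / ennreal (r ^ Suc ?n) * indicator {0<..} r) \<partial>lborel)"
    unfolding axis_modular_def
  proof (intro sum_mono nn_integral_mono)
    fix j :: 'n and r :: real
    let ?i = "increment_modular (2 * l) (r *\<^sub>R axis j 1)"
    show "?i / ennreal r * indicator {0<..} r \<le>
      ennreal ?c * (?I r / ennreal (r ^ Suc ?n) * indicator {0<..} r)"
    proof (cases "r > 0")
      case True
      define q where "q = unit_ball_vol ?n * (r / 2) ^ ?n"
      have q: "q > 0" using True w by (simp add: q_def)
      have "ennreal (1 / q) * ennreal q = ennreal (1 / q * q)"
        using q by (intro ennreal_mult'[symmetric]) simp
      then have "?i = ennreal (1 / q) * (ennreal q * ?i)"
        using q by (simp flip: mult.assoc)
      also have "\<dots> \<le> ennreal (1 / q) * (2 * ?I r)"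
        unfolding q_def using True assms
        by (intro mult_left_mono increment_modular_axis_le_average) auto
      also have "\<dots> = ennreal (1 / q) * ennreal 2 * ?I r"
        by (simp add: mult.assoc)
      also have "ennreal (1 / q) * ennreal 2 = ennreal (1 / q * 2)"
        using q by (intro ennreal_mult'[symmetric]) simp
      also have "1 / q * 2 = ?c / r ^ ?n"
        by (simp add: q_def power_divide)
      finally have "?i / ennreal r \<le> ennreal (?c / r ^ ?n) * ?I r / ennreal r"
        by (rule divide_right_mono_ennreal)
      also have "\<dots> = (ennreal (?c / r ^ ?n) * ennreal (1 / r)) * ?I r"
        using True by (simp add: divide_ennreal_def inverse_ennreal inverse_eq_divide mult_ac)
      also have "ennreal (?c / r ^ ?n) * ennreal (1 / r) = ennreal ?c * ennreal (1 / r ^ Suc ?n)"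
        using True by (simp add: ennreal_mult'[symmetric] mult_ac)
      finally show ?thesis
        using True by (simp add: divide_ennreal_def inverse_ennreal inverse_eq_divide mult_ac)
    qed simp
  qed
  also have "\<dots> = of_nat ?n * (ennreal ?c * (\<integral>\<^sup>+r\<in>{0<..}. ?I r / ennreal (r ^ Suc ?n) \<partial>lborel))"
    by (subst nn_integral_cmult) auto
  also have "\<dots> = ennreal ?c * gagliardo_modular l"
    unfolding gagliardo_modular_def
    by (subst radial_layer_cake) (auto simp: Suc_leI mult_ac)
  finally show ?thesis .
qed

end

section \<open>Young functions and gauges\<close>

text \<open>
  The form in which an estimate between modulars yields one between Luxemburg type
  gauges.
\<close>
lemma Inf_scaled_le:
  assumes "K > 0" and PQ: "\<And>l. l > 0 \<Longrightarrow> P l \<Longrightarrow> Q (K * l)"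
  shows "Inf {ennreal l |l. l > 0 \<and> Q l} \<le> ennreal K * Inf {ennreal l |l. l > 0 \<and> P l}"
proof -
  have K: "ennreal K * ennreal (1 / K) = 1"
    using assms(1) by (simp add: ennreal_mult'[symmetric])
  have "ennreal (1 / K) * Inf {ennreal l |l. l > 0 \<and> Q l} \<le> Inf {ennreal l |l. l > 0 \<and> P l}"
  proof (rule Inf_greatest)
    fix y assume "y \<in> {ennreal l |l. l > 0 \<and> P l}"
    then obtain l where l: "y = ennreal l" "l > 0" "P l" by auto
    have "Inf {ennreal l |l. l > 0 \<and> Q l} \<le> ennreal (K * l)"
      using l PQ assms(1) by (intro Inf_lower) auto
    then have "ennreal (1 / K) * Inf {ennreal l |l. l > 0 \<and> Q l} \<le> ennreal (1 / K) * ennreal (K * l)"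
      by (rule mult_left_mono) simp
    also have "\<dots> = y"
      using l assms(1) by (simp add: ennreal_mult'[symmetric])
    finally show "ennreal (1 / K) * Inf {ennreal l |l. l > 0 \<and> Q l} \<le> y" .
  qed
  then have "ennreal K * (ennreal (1 / K) * Inf {ennreal l |l. l > 0 \<and> Q l}) \<le>
      ennreal K * Inf {ennreal l |l. l > 0 \<and> P l}"
    by (rule mult_left_mono) simp
  then show ?thesis by (simp add: K mult.assoc[symmetric])
qed

lemma young_function_contract:
  assumes "young_function A" "1 \<le> K" "0 \<le> t"
  shows "A (t / K) \<le> A t / ennreal K"
proof -
  have "A ((1 - 1 / K) * 0 + (1 / K) * t) \<le> ennreal (1 - 1 / K) * A 0 + ennreal (1 / K) * A t"
  proof -
    have "\<forall>x\<ge>0. \<forall>y\<ge>0. \<forall>t\<in>{0..1}. A ((1 - t) * x + t * y) \<le> ennreal (1 - t) * A x + ennreal t * A y"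
      using assms(1) by (simp add: young_function_def)
    from this[rule_format, of 0 t "1 / K"] assms show ?thesis by simp
  qed
  moreover have "A 0 = 0" using assms unfolding young_function_def by auto
  moreover have "ennreal (1 / K) * A t = A t / ennreal K"
    using assms by (simp add: divide_ennreal_def inverse_ennreal inverse_eq_divide mult.commute)
  ultimately show ?thesis by simp
qed

lemma young_function_mono:
  assumes A: "young_function A" and ab: "0 \<le> a" "a \<le> b"
  shows "A a \<le> A b"
proof (cases "a = 0")
  case True
  then show ?thesis using A unfolding young_function_def by auto
next
  case False
  then have K: "1 \<le> b / a" using ab by simp
  have "A a \<le> A b / ennreal (b / a)"
    using young_function_contract[OF A K, of b] ab False by simp
  also have "\<dots> \<le> A b"
    using K ab False mult_left_mono[of "ennreal (a / b)" 1 "A b"]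
    by (simp add: divide_ennreal_def inverse_ennreal inverse_eq_divide)
  finally show ?thesis by simp
qed

section \<open>Comparison of the two seminorms\<close>

definition frac_modular ::
  "real \<Rightarrow> (real \<Rightarrow> ennreal) \<Rightarrow> 'i set \<Rightarrow> ('i \<Rightarrow> real^'n \<Rightarrow> real) \<Rightarrow> real \<Rightarrow> ennreal" where
  "frac_modular s A I U l =
    (\<integral>\<^sup>+y. (\<integral>\<^sup>+x. A (L2_set (\<lambda>i. U i x - U i y) I / (l * norm (x - y) powr s))
                 / ennreal (norm (x - y) ^ CARD('n)) \<partial>lebesgue) \<partial>lebesgue)"

definition besov_modular ::
  "real \<Rightarrow> (real \<Rightarrow> ennreal) \<Rightarrow> 'i set \<Rightarrow> ('i \<Rightarrow> real^'n \<Rightarrow> real) \<Rightarrow> real \<Rightarrow> ennreal" where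
  "besov_modular s A I U l =
    (\<Sum>j\<in>UNIV. \<integral>\<^sup>+r\<in>{0<..}.
          ((\<integral>\<^sup>+x. A (L2_set (\<lambda>i. U i (x + r *\<^sub>R axis j 1) - U i x) I / (l * r powr s)) \<partial>lebesgue)
             / ennreal r) \<partial>lebesgue)"

lemma frac_seminorm_eq:
  "frac_seminorm s A I U = Inf {ennreal l |l. l > 0 \<and> frac_modular s A I U l \<le> 1}"
  by (simp add: frac_seminorm_def frac_modular_def)

lemma besov_seminorm_eq:
  "besov_seminorm s A I U = Inf {ennreal l |l. l > 0 \<and> besov_modular s A I U l \<le> 1}"
  by (simp add: besov_seminorm_def besov_modular_def)

lemma AE_lborel_translate:
  fixes c :: "'a::euclidean_space"
  assumes "AE x in lborel. P x"
  shows "AE x in lborel. P (x + c)"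
proof -
  obtain N where N: "{x. \<not> P x} \<subseteq> N" "N \<in> null_sets lborel"
    using assms unfolding eventually_ae_filter by auto
  then have "{x. x - (- c) \<in> N} \<in> null_sets lborel"
    by (intro null_sets_translation)
  then show ?thesis
    by (rule AE_I') (use N in auto)
qed

lemma borel_representative_family:
  fixes U :: "'i \<Rightarrow> real^'n \<Rightarrow> real"
  assumes "finite I" "\<forall>i\<in>I. U i \<in> borel_measurable lebesgue"
  obtains V where "\<And>i. V i \<in> borel_measurable borel" "AE x in lborel. \<forall>i\<in>I. U i x = V i x"
proof -
  have "\<forall>i\<in>I. \<exists>v. v \<in> borel_measurable borel \<and> (AE x in lborel. U i x = v x)"
    using completion_ex_borel_measurable_real assms(2) by fastforce
  then obtain V where V: "\<forall>i\<in>I. V i \<in> borel_measurable borel \<and> (AE x in lborel. U i x = V i x)"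
    by metis
  show thesis
  proof (rule that[of "\<lambda>i. if i \<in> I then V i else (\<lambda>_. 0)"])
    show "(if i \<in> I then V i else (\<lambda>_. 0)) \<in> borel_measurable borel" for i using V by auto
    show "AE x in lborel. \<forall>i\<in>I. U i x = (if i \<in> I then V i else (\<lambda>_. 0)) x"
      using V assms(1) by (auto simp: AE_finite_all)
  qed
qed

context
  fixes A :: "real \<Rightarrow> ennreal" and U :: "'i \<Rightarrow> real^'n::finite \<Rightarrow> real" and I :: "'i set" and s :: real
  assumes A: "young_function A" and I: "finite I"
    and U: "\<And>i. i \<in> I \<Longrightarrow> U i \<in> borel_measurable lebesgue" and s: "0 \<le> s"
begin

text \<open>
  Borel representatives of the \<open>U i\<close> make the integrands jointly measurable, as Tonelli's
  theorem requires; the modulars are insensitive to the change on a null set. Since a Young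
  function is constrained on \<open>[0,\<infinity>)\<close> only, it is precomposed with \<open>max 0\<close>.
\<close>
lemma modulars_of_family:
  obtains d where
    "modulated_distance (\<lambda>t. A (max 0 t)) (d :: real^'n \<Rightarrow> _) s"
    "\<And>l. l > 0 \<Longrightarrow> frac_modular s A I U l =
        modulated_distance.gagliardo_modular (\<lambda>t. A (max 0 t)) d s l"
    "\<And>l. l > 0 \<Longrightarrow> besov_modular s A I U l =
        modulated_distance.axis_modular (\<lambda>t. A (max 0 t)) d s l"
proof -
  obtain V where V [measurable]: "\<And>i. V i \<in> borel_measurable borel"
    and UV: "AE x in lborel. \<forall>i\<in>I. U i x = V i x"
    using borel_representative_family[OF I, of U] U by blast
  define B where "B = (\<lambda>t. A (max 0 t))"
  define d where "d x y = L2_set (\<lambda>i. V i x - V i y) I" for x y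
  have B: "A t = B t" if "0 \<le> t" for t using that by (simp add: B_def)
  interpret modulated_distance B d s
  proof
    show "mono B"
      unfolding B_def by (intro monoI young_function_mono[OF A]) auto
    show "B 0 = 0" using A by (simp add: B_def young_function_def)
    show "B (t / K) \<le> B t / ennreal K" if "1 \<le> K" "0 \<le> t" for t K
      using young_function_contract[OF A that] that by (simp add: B_def)
    show "case_prod d \<in> borel_measurable (borel \<Otimes>\<^sub>M borel)"
      unfolding d_def L2_set_def by measurable
    show "0 \<le> d x y" for x y by (simp add: d_def)
    show "d x x = 0" for x by (simp add: d_def L2_set_def)
    show "d x y = d y x" for x y by (simp add: d_def L2_set_def power2_commute)
    show "d x z \<le> d x y + d y z" for x y z
      using L2_set_triangle_ineq[of "\<lambda>i. V i x - V i y" "\<lambda>i. V i y - V i z" I]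
      by (simp add: d_def)
    show "0 \<le> s" by (rule s)
  qed
  have UVd: "A (L2_set (\<lambda>i. U i x - U i y) I / q) = B (d x y / q)"
    if "\<forall>i\<in>I. U i x = V i x" "\<forall>i\<in>I. U i y = V i y" "0 \<le> q" for x y q
  proof -
    have "L2_set (\<lambda>i. U i x - U i y) I = d x y"
      unfolding d_def using that by (intro L2_set_cong) auto
    then show ?thesis using that d_nonneg by (simp add: B)
  qed
  have frac: "frac_modular s A I U l = gagliardo_modular l" if l: "l > 0" for l
  proof -
    let ?Q = "\<lambda>x y. B (d x y / (l * norm (x - y) powr s)) / ennreal (norm (x - y) ^ CARD('n))"
    have "frac_modular s A I U l = (\<integral>\<^sup>+y. (\<integral>\<^sup>+x. ?Q x y \<partial>lborel) \<partial>lborel)"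
      unfolding frac_modular_def nn_integral_completion
    proof (rule nn_integral_cong_AE, rule eventually_mono[OF UV])
      fix y assume "\<forall>i\<in>I. U i y = V i y"
      then show "(\<integral>\<^sup>+x. A (L2_set (\<lambda>i. U i x - U i y) I / (l * norm (x - y) powr s))
                 / ennreal (norm (x - y) ^ CARD('n)) \<partial>lborel) = (\<integral>\<^sup>+x. ?Q x y \<partial>lborel)"
        using l by (intro nn_integral_cong_AE eventually_mono[OF UV]) (simp add: UVd)
    qed
    also have "\<dots> = (\<integral>\<^sup>+y. (\<integral>\<^sup>+h. ?Q (h + y) y \<partial>lborel) \<partial>lborel)"
      by (intro nn_integral_cong nn_integral_lborel_translate[symmetric]) measurable
    also have "\<dots> = (\<integral>\<^sup>+h. (\<integral>\<^sup>+y. ?Q (h + y) y \<partial>lborel) \<partial>lborel)"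
      by (rule lborel_pair.Fubini') measurable
    also have "\<dots> = gagliardo_modular l"
      unfolding gagliardo_modular_def increment_modular_def
      by (intro nn_integral_cong, subst nn_integral_divide[symmetric]) (auto simp: add.commute)
    finally show ?thesis .
  qed
  have besov: "besov_modular s A I U l = axis_modular l" if l: "l > 0" for l
    unfolding besov_modular_def axis_modular_def increment_modular_def nn_integral_completion
  proof (intro sum.cong refl nn_integral_cong)
    fix j :: 'n and r :: real
    have "(\<integral>\<^sup>+x. A (L2_set (\<lambda>i. U i (x + r *\<^sub>R axis j 1) - U i x) I / (l * r powr s)) \<partial>lborel) =
        (\<integral>\<^sup>+x. B (d (x + r *\<^sub>R axis j 1) x / (l * r powr s)) \<partial>lborel)"
      using l by (intro nn_integral_cong_AE
        eventually_mono[OF eventually_conj[OF UV AE_lborel_translate[OF UV, of "r *\<^sub>R axis j 1"]]]) (simp add: UVd)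
    then show "(\<integral>\<^sup>+x. A (L2_set (\<lambda>i. U i (x + r *\<^sub>R axis j 1) - U i x) I / (l * r powr s)) \<partial>lborel)
          / ennreal r * indicator {0<..} r =
        (\<integral>\<^sup>+x. B (d (x + r *\<^sub>R axis j 1) x / (l * norm (r *\<^sub>R axis j 1 :: real^'n) powr s)) \<partial>lborel)
          / ennreal r * indicator {0<..} r"
      by (auto simp: indicator_def)
  qed
  show thesis
    using that[of d] modulated_distance_axioms frac besov unfolding B_def by blast
qed

text \<open>
  One factor \<open>n\<close> comes from the change of the parameter from \<open>l\<close> to \<open>n * l\<close>, the factor
  \<open>n * 2 ^ n\<close> from the absorption of the constant in front of the modular.
\<close>
lemma frac_seminorm_le_besov_seminorm:
  "frac_seminorm s A I U \<le> ennreal (real CARD('n) ^ 2 * 2 ^ CARD('n)) * besov_seminorm s A I U"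
proof -
  obtain d where "modulated_distance (\<lambda>t. A (max 0 t)) (d :: real^'n \<Rightarrow> _) s"
    and frac: "\<And>l. l > 0 \<Longrightarrow> frac_modular s A I U l =
        modulated_distance.gagliardo_modular (\<lambda>t. A (max 0 t)) d s l"
    and besov: "\<And>l. l > 0 \<Longrightarrow> besov_modular s A I U l =
        modulated_distance.axis_modular (\<lambda>t. A (max 0 t)) d s l"
    using modulars_of_family by blast
  then interpret modulated_distance "\<lambda>t. A (max 0 t)" d s by simp
  show ?thesis
    unfolding frac_seminorm_eq besov_seminorm_eq
  proof (rule Inf_scaled_le, simp)
    let ?n = "real CARD('n)"
    let ?K = "?n * 2 ^ CARD('n)"
    fix l :: real assume l: "l > 0"
    have n: "1 \<le> ?n" by (simp add: Suc_leI)
    then have K: "1 \<le> ?K" using mult_mono[of 1 ?n 1 "2 ^ CARD('n)"] by simp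
    assume "besov_modular s A I U l \<le> 1"
    then have le1: "axis_modular l \<le> 1" using besov l by simp
    have "gagliardo_modular (?K * (?n * l)) \<le> gagliardo_modular (?n * l) / ennreal ?K"
      using K n l by (intro gagliardo_modular_contract) auto
    also have "\<dots> \<le> ennreal ?K * axis_modular l / ennreal ?K"
      using l by (intro divide_right_mono_ennreal gagliardo_modular_le_axis_modular)
    also have "\<dots> = axis_modular l"
      using K by (simp add: mult.commute[of "ennreal _"] ennreal_mult_divide_eq)
    finally have "gagliardo_modular (?n ^ 2 * 2 ^ CARD('n) * l) \<le> 1"
      using le1 by (simp add: power2_eq_square mult_ac)
    then show "frac_modular s A I U (?n ^ 2 * 2 ^ CARD('n) * l) \<le> 1"
      using l by (subst frac) auto
  qed
qed

text \<open>
  A constant is absorbed by contraction, which is available for constants at least \<open>1\<close>;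
  hence the maximum.
\<close>
lemma besov_seminorm_le_frac_seminorm:
  "besov_seminorm s A I U \<le>
    ennreal (2 * max 1 (2 ^ Suc CARD('n) / unit_ball_vol CARD('n))) * frac_seminorm s A I U"
proof -
  obtain d where "modulated_distance (\<lambda>t. A (max 0 t)) (d :: real^'n \<Rightarrow> _) s"
    and frac: "\<And>l. l > 0 \<Longrightarrow> frac_modular s A I U l =
        modulated_distance.gagliardo_modular (\<lambda>t. A (max 0 t)) d s l"
    and besov: "\<And>l. l > 0 \<Longrightarrow> besov_modular s A I U l =
        modulated_distance.axis_modular (\<lambda>t. A (max 0 t)) d s l"
    using modulars_of_family by blast
  then interpret modulated_distance "\<lambda>t. A (max 0 t)" d s by simp
  show ?thesis
    unfolding frac_seminorm_eq besov_seminorm_eq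
  proof (rule Inf_scaled_le, simp)
    let ?c = "2 ^ Suc CARD('n) / unit_ball_vol CARD('n)"
    let ?K = "max 1 ?c"
    fix l :: real assume l: "l > 0"
    assume "frac_modular s A I U l \<le> 1"
    then have le1: "gagliardo_modular l \<le> 1" using frac l by simp
    have "axis_modular (?K * (2 * l)) \<le> axis_modular (2 * l) / ennreal ?K"
      using l by (intro axis_modular_contract) auto
    also have "\<dots> \<le> ennreal ?c * gagliardo_modular l / ennreal ?K"
      using l by (intro divide_right_mono_ennreal axis_modular_le_gagliardo_modular)
    also have "\<dots> \<le> ennreal ?K * gagliardo_modular l / ennreal ?K"
      by (intro divide_right_mono_ennreal mult_right_mono ennreal_leI) auto
    also have "\<dots> = gagliardo_modular l"
      by (simp add: mult.commute[of "ennreal _"] ennreal_mult_divide_eq)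
    finally have "axis_modular (2 * ?K * l) \<le> 1"
      using le1 by (simp add: mult_ac)
    then show "besov_modular s A I U (2 * ?K * l) \<le> 1"
      using l by (subst besov) auto
  qed
qed

end

section \<open>Fractional Orlicz-Sobolev and Besov spaces\<close>

lemma finite_multi_indices: "finite (multi_indices k :: ('n::finite \<Rightarrow> nat) set)"
proof (rule finite_subset)
  show "multi_indices k \<subseteq> (UNIV :: 'n set) \<rightarrow>\<^sub>E {..k}"
    by (auto simp: multi_indices_def intro: member_le_sum)
qed (simp add: finite_PiE)

text \<open>
  Membership in the Sobolev space guarantees that the choice defining the weak derivative
  is a meaningful one.
\<close>
lemma weak_deriv_measurable:
  assumes "u \<in> sobolev_space m A" "\<alpha> \<in> multi_indices m"
  shows "weak_deriv \<alpha> u \<in> borel_measurable lebesgue"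
proof (cases "\<alpha> = (\<lambda>_. 0)")
  case True
  then show ?thesis using assms by (simp add: weak_deriv_def sobolev_space_def orlicz_space_def)
next
  case False
  then have "m \<noteq> 0" using assms by (auto simp: multi_indices_0)
  then have "\<exists>v. has_weak_deriv \<alpha> u v" using assms by (auto simp: sobolev_space_def)
  then have "has_weak_deriv \<alpha> u (weak_deriv \<alpha> u)"
    using False by (simp add: weak_deriv_def someI_ex)
  then show ?thesis by (simp add: has_weak_deriv_def locally_integrable_def)
qed

theorem theorem3p1:
  "\<exists>c1>0. \<exists>c2>0. \<forall>(s::real) (A::real \<Rightarrow> ennreal).
     s > 0 \<and> s \<notin> \<nat> \<and> young_function A \<longrightarrow>
       besov_space s A = (frac_sobolev_space s A :: (real^'n::finite \<Rightarrow> real) set) \<and>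
       (\<forall>u \<in> (besov_space s A :: (real^'n \<Rightarrow> real) set).
          ennreal c1 * besov_norm s A u \<le> frac_sobolev_norm s A u \<and>
          frac_sobolev_norm s A u \<le> ennreal c2 * besov_norm s A u)"
proof -
  define K where "K = 2 * max 1 (2 ^ Suc CARD('n) / unit_ball_vol CARD('n))"
  define c where "c = real CARD('n) ^ 2 * 2 ^ CARD('n)"
  have K: "1 \<le> K" by (simp add: K_def)
  have c: "1 \<le> c"
  proof -
    have "1 \<le> real CARD('n) ^ 2" by (simp add: Suc_leI)
    then show ?thesis using mult_mono[of 1 "real CARD('n) ^ 2" 1 "2 ^ CARD('n)"] by (simp add: c_def)
  qed
  \<comment> \<open>The Sobolev part is common to both norms; a constant at least \<open>1\<close> covers it as well.\<close>
  have absorb: "a + b \<le> ennreal C * (a + b')" if "1 \<le> C" "b \<le> ennreal C * b'" for a b b' C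
  proof -
    have "a \<le> ennreal C * a"
      using mult_right_mono[of 1 "ennreal C" a] that by (simp add: ennreal_ge_1)
    then show ?thesis using that by (simp add: distrib_left add_mono)
  qed
  have "besov_space s A = (frac_sobolev_space s A :: (real^'n \<Rightarrow> real) set) \<and>
       (\<forall>u \<in> (besov_space s A :: (real^'n \<Rightarrow> real) set).
          ennreal (1 / K) * besov_norm s A u \<le> frac_sobolev_norm s A u \<and>
          frac_sobolev_norm s A u \<le> ennreal c * besov_norm s A u)"
    if A: "young_function A" for s A
  proof -
    let ?m = "nat \<lfloor>s\<rfloor>"
    let ?F = "\<lambda>u :: real^'n \<Rightarrow> real. frac_seminorm (frac s) A (multi_indices ?m) (\<lambda>\<alpha>. weak_deriv \<alpha> u)"
    let ?B = "\<lambda>u :: real^'n \<Rightarrow> real. besov_seminorm (frac s) A (multi_indices ?m) (\<lambda>\<alpha>. weak_deriv \<alpha> u)"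
    have FB: "?F u \<le> ennreal c * ?B u" if "u \<in> sobolev_space ?m A" for u
      unfolding c_def using weak_deriv_measurable[OF that]
      by (intro frac_seminorm_le_besov_seminorm A finite_multi_indices) auto
    have BF: "?B u \<le> ennreal K * ?F u" if "u \<in> sobolev_space ?m A" for u
      unfolding K_def using weak_deriv_measurable[OF that]
      by (intro besov_seminorm_le_frac_seminorm A finite_multi_indices) auto
    have "?F u < \<infinity> \<longleftrightarrow> ?B u < \<infinity>" if "u \<in> sobolev_space ?m A" for u
      using FB[OF that] BF[OF that]
      by (auto intro: le_less_trans simp: ennreal_mult_less_top)
    then have eq: "besov_space s A = (frac_sobolev_space s A :: (real^'n \<Rightarrow> real) set)"
      unfolding besov_space_def frac_sobolev_space_def by blast
    moreover have "ennreal (1 / K) * besov_norm s A u \<le> frac_sobolev_norm s A u"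
      if "u \<in> besov_space s A" for u :: "real^'n \<Rightarrow> real"
    proof -
      have "besov_norm s A u \<le> ennreal K * frac_sobolev_norm s A u"
        unfolding besov_norm_def frac_sobolev_norm_def
        using that by (intro absorb K BF) (simp add: besov_space_def)
      then have "ennreal (1 / K) * besov_norm s A u \<le>
          ennreal (1 / K) * (ennreal K * frac_sobolev_norm s A u)"
        by (rule mult_left_mono) simp
      also have "\<dots> = (ennreal (1 / K) * ennreal K) * frac_sobolev_norm s A u"
        by (simp only: mult.assoc)
      also have "ennreal (1 / K) * ennreal K = 1"
        using K by (simp flip: ennreal_mult')
      finally show ?thesis by simp
    qed
    moreover have "frac_sobolev_norm s A u \<le> ennreal c * besov_norm s A u"
      if "u \<in> besov_space s A" for u :: "real^'n \<Rightarrow> real"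
      unfolding besov_norm_def frac_sobolev_norm_def
      using that by (intro absorb c FB) (simp add: besov_space_def)
    ultimately show ?thesis by blast
  qed
  moreover have "0 < 1 / K" "0 < c" using K c by auto
  ultimately show ?thesis by blast
qed

end
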